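(* Let $\mathsf X$ be a Polish space with its Borel sigma-algebra and let $\mathcal P$ be a nonempty weakly compact set of Borel probability measures on $\mathsf X$. Then every Borel probability measure $Q\notin\mathcal P$ admits a bounded continuous symmetric function $h_Q:\mathsf X^2\to\mathbb R$ such that $$\sup_{P\in\mathcal P}\mathbb E_{P^2}h_Q\le0<\mathbb E_{Q^2}h_Q.$$ Consequently, for every nonempty set $\mathcal Q$ of Borel probability measures on $\mathsf X$ disjoint from $\mathcal P$, the pair $(\mathcal P,\mathcal Q)$ is sequentially testable, and all certificates may be taken of degree two: there is a countable family of bounded measurable $h_m:\mathsf X^2\to\mathbb R$ with $\sup_{P\in\mathcal P}\mathbb E_{P^2}h_m\le0$ for every $m$ and such that every $Q\in\mathcal Q$ satisfies $\mathbb E_{Q^2}h_m>0$ for some $m$.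
   Context: Weak compactness refers to the topology of weak convergence of probability measures (generated by the maps $P\mapsto\mathbb E_Pf$, $f$ bounded continuous). For a probability measure $R$ on $\mathsf X$, $R^n$ and $R^\infty$ denote i.i.d. product laws on $\mathsf X^n$ and $\mathsf X^{\mathbb N}$; $(X_i)_{i\ge1}$ is the coordinate process and $\mathcal F_n=\sigma(X_1,\dots,X_n)$. A sequential test is an $(\mathcal F_n)$-stopping time $\tau$ with values in $\{1,2,\dots\}\cup\{\infty\}$. It is level-$\alpha$ for $\mathcal P$ if $\sup_{P\in\mathcal P}P^\infty(\tau<\infty)\le\alpha$, and has power one against $Q$ if $Q^\infty(\tau<\infty)=1$. The pair $(\mathcal P,\mathcal Q)$ is called sequentially testable if the following equivalent conditions hold: for some $\alpha\in(0,1)$ there is a level-$\alpha$ test with power one against every $Q\in\mathcal Q$; for every $\alpha\in(0,1)$ there is such a test; there is a countable family $(n_m,h_m)_{m\ge1}$ of bounded measurable $h_m:\mathsf X^{n_m}\to\mathbb R$ with $\sup_{P\in\mathcal P}\mathbb E_{P^{n_m}}h_m\le0$ for every $m$ and such that each $Q\in\mathcal Q$ has $\mathbb E_{Q^{n_m}}h_m>0$ for some $m$. *)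

theory Defs
  imports "HOL-Probability.Probability"
begin

text \<open>
  Borel probability measures are the elements of \<^term>\<open>space (prob_algebra borel)\<close>.
  Points of the power \<open>X\<^sup>n\<close> are extensional functions on \<^term>\<open>{..<n}\<close>, points of the infinite
  power are functions on \<^typ>\<open>nat\<close>; hence the coordinate \<open>X\<^sub>i\<close> (\<open>i \<ge> 1\<close>) is \<open>\<lambda>\<omega>. \<omega> (i - 1)\<close>.
\<close>

definition weak_topology :: "'a::topological_space measure topology" where
  "weak_topology = topology_generated_by
     {{P \<in> space (prob_algebra borel). (\<integral>x. f x \<partial>P) \<in> U} | (f :: 'a \<Rightarrow> real) U.
        continuous_on UNIV f \<and> bounded (range f) \<and> open U}"

abbreviation iid_power :: "nat \<Rightarrow> 'a measure \<Rightarrow> (nat \<Rightarrow> 'a) measure" where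
  "iid_power n R \<equiv> Pi\<^sub>M {..<n} (\<lambda>_. R)"

abbreviation iid_seq :: "'a measure \<Rightarrow> (nat \<Rightarrow> 'a) measure" where
  "iid_seq R \<equiv> Pi\<^sub>M UNIV (\<lambda>_. R)"

text \<open>
  The index is extended by \<open>\<infinity>\<close> so that \<^const>\<open>stopping_time\<close> applies to times valued in
  \<^typ>\<open>enat\<close>. At \<open>\<infinity>\<close> the sigma-algebra is generated by all coordinates, and the
  stopping condition there is void.
\<close>

definition coord_filtration :: "enat \<Rightarrow> (nat \<Rightarrow> 'a::topological_space) measure" where
  "coord_filtration n =
     sigma UNIV {(\<lambda>\<omega>. \<omega> i) -` A | i A. enat i < n \<and> A \<in> sets borel}"

definition sequential_test :: "((nat \<Rightarrow> 'a::topological_space) \<Rightarrow> enat) \<Rightarrow> bool" where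
  "sequential_test \<tau> \<longleftrightarrow> stopping_time coord_filtration \<tau> \<and> (\<forall>\<omega>. 1 \<le> \<tau> \<omega>)"

definition level_test ::
    "real \<Rightarrow> 'a::topological_space measure set \<Rightarrow> ((nat \<Rightarrow> 'a) \<Rightarrow> enat) \<Rightarrow> bool" where
  "level_test \<alpha> \<P> \<tau> \<longleftrightarrow> (SUP P\<in>\<P>. emeasure (iid_seq P) {\<omega>. \<tau> \<omega> < \<infinity>}) \<le> ennreal \<alpha>"

definition power_one :: "'a::topological_space measure \<Rightarrow> ((nat \<Rightarrow> 'a) \<Rightarrow> enat) \<Rightarrow> bool" where
  "power_one Q \<tau> \<longleftrightarrow> emeasure (iid_seq Q) {\<omega>. \<tau> \<omega> < \<infinity>} = 1"

definition testable_at_level ::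
    "real \<Rightarrow> 'a::topological_space measure set \<Rightarrow> 'a measure set \<Rightarrow> bool" where
  "testable_at_level \<alpha> \<P> \<Q> \<longleftrightarrow>
     (\<exists>\<tau>. sequential_test \<tau> \<and> level_test \<alpha> \<P> \<tau> \<and> (\<forall>Q\<in>\<Q>. power_one Q \<tau>))"

text \<open>
  Suprema of expectations are taken in \<^typ>\<open>ereal\<close>, where they always exist; the expectations
  themselves are finite because the functions are bounded. A finite family of certificates is
  covered by repeating its members or by padding with zero functions.
\<close>

definition certifying_family ::
    "'a::topological_space measure set \<Rightarrow> 'a measure set \<Rightarrow>
     (nat \<Rightarrow> nat) \<Rightarrow> (nat \<Rightarrow> (nat \<Rightarrow> 'a) \<Rightarrow> real) \<Rightarrow> bool" where
  "certifying_family \<P> \<Q> n h \<longleftrightarrow>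
     (\<forall>m. 1 \<le> n m \<and>
          h m \<in> borel_measurable (iid_power (n m) borel) \<and>
          bounded (h m ` space (iid_power (n m) borel)) \<and>
          (SUP P\<in>\<P>. ereal (\<integral>x. h m x \<partial>iid_power (n m) P)) \<le> 0) \<and>
     (\<forall>Q\<in>\<Q>. \<exists>m. 0 < (\<integral>x. h m x \<partial>iid_power (n m) Q))"

text \<open>
  The three conditions are equivalent characterisations of sequential testability;
  the definition asks for all of them, so that it does not depend on a proof of the equivalence.
\<close>

definition sequentially_testable ::
    "'a::topological_space measure set \<Rightarrow> 'a measure set \<Rightarrow> bool" where
  "sequentially_testable \<P> \<Q> \<longleftrightarrow>
     (\<exists>\<alpha>\<in>{0<..<1}. testable_at_level \<alpha> \<P> \<Q>) \<and>
     (\<forall>\<alpha>\<in>{0<..<1}. testable_at_level \<alpha> \<P> \<Q>) \<and>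
     (\<exists>n h. certifying_family \<P> \<Q> n h)"

definition bounded_continuous_on_power ::
    "nat \<Rightarrow> ((nat \<Rightarrow> 'a::topological_space) \<Rightarrow> real) \<Rightarrow> bool" where
  "bounded_continuous_on_power n h \<longleftrightarrow>
     continuous_map (product_topology (\<lambda>_. euclidean) {..<n}) euclideanreal h \<and>
     bounded (h ` ({..<n} \<rightarrow>\<^sub>E UNIV))"

definition symmetric_on_power :: "nat \<Rightarrow> ((nat \<Rightarrow> 'a) \<Rightarrow> real) \<Rightarrow> bool" where
  "symmetric_on_power n h \<longleftrightarrow>
     (\<forall>\<pi>. \<pi> permutes {..<n} \<longrightarrow> (\<forall>x \<in> {..<n} \<rightarrow>\<^sub>E UNIV. h (\<lambda>i. x (\<pi> i)) = h x))"

end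

theory Submission
  imports Defs
begin

text \<open>
  Fix a countable measure-determining family of bounded continuous functions \<open>f\<^sub>i\<close>. By weak
  compactness finitely many of them separate \<open>Q\<close> uniformly from \<open>\<P>\<close>: the squared distance
  between the mean vectors of \<open>P\<close> and \<open>Q\<close> is bounded below on \<open>\<P>\<close>. As a squared
  mean is a degree-two expectation, \<open>h(x, y) = c - (\<Sum>i. (f\<^sub>i x - q\<^sub>i) (f\<^sub>i y - q\<^sub>i))\<close> is a
  certificate once \<open>q\<close> is close to the mean vector of \<open>Q\<close> and \<open>c\<close> is suitable. Taking
  \<open>q\<close> and \<open>c\<close> rational leaves only countably many certificates for all \<open>Q\<close> at once.
  A sequential test rejects when a block average of some certificate is large, the block lengths
  being chosen by Hoeffding's inequality.
\<close>

section \<open>A countable measure-determining family\<close>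

text \<open>The integrands increase with \<open>k\<close> to the indicator of \<open>U\<close> and
  are bounded by 1, so dominated convergence applies. The case \<open>U = UNIV\<close> is excluded
  because \<open>infdist\<close> to the empty set is 0 by convention.\<close>

lemma integral_infdist_tendsto_measure:
  fixes U :: "'a::metric_space set"
  assumes P: "P \<in> space (prob_algebra borel)" and U: "open U" "U \<noteq> UNIV"
  shows "(\<lambda>k. \<integral>x. min 1 (real k * infdist x (- U)) \<partial>P) \<longlonglongrightarrow> measure P U"
proof -
  interpret prob_space P using P by (simp add: space_prob_algebra)
  have [measurable_cong]: "sets P = sets borel" using P by (simp add: space_prob_algebra)
  have [measurable]: "U \<in> sets P" using U by simp
  have [measurable]: "(\<lambda>x. infdist x (- U)) \<in> borel_measurable borel"
    by (intro borel_measurable_continuous_onI continuous_intros)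
  have "(\<lambda>k. \<integral>x. min 1 (real k * infdist x (- U)) \<partial>P) \<longlonglongrightarrow> (\<integral>x. indicator U x \<partial>P)"
  proof (rule integral_dominated_convergence[where w = "\<lambda>_. 1"])
    show "AE x in P. (\<lambda>k. min 1 (real k * infdist x (- U))) \<longlonglongrightarrow> (indicator U x :: real)"
    proof (intro AE_I2)
      fix x
      show "(\<lambda>k. min 1 (real k * infdist x (- U))) \<longlonglongrightarrow> (indicator U x :: real)"
      proof (cases "x \<in> U")
        case True
        have "closed (- U)" "- U \<noteq> {}" using U by auto
        with True have pos: "infdist x (- U) > 0"
          using in_closed_iff_infdist_zero[of "- U" x] infdist_nonneg[of x "- U"] by force
        obtain K where K: "1 < real K * infdist x (- U)"
          using reals_Archimedean3[OF pos] by blast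
        have "min 1 (real k * infdist x (- U)) = 1" if "k \<ge> K" for k
        proof -
          have "real K * infdist x (- U) \<le> real k * infdist x (- U)"
            using that pos by (intro mult_right_mono) auto
          then show ?thesis using K by simp
        qed
        then have "eventually (\<lambda>k. min 1 (real k * infdist x (- U)) = indicator U x) sequentially"
          using True by (auto simp: eventually_sequentially)
        then show ?thesis by (rule tendsto_eventually)
      next
        case False
        then have "infdist x (- U) = 0" by simp
        then show ?thesis using False by simp
      qed
    qed
  qed (auto simp: infdist_nonneg)
  then show ?thesis by simp
qed

text \<open>The finite intersections of a countable basis form an intersection-stable generator of
  the Borel sets, so a probability measure is determined by its values there. These values are
  limits of integrals of the ramp functions of the previous lemma, countably many in all.\<close>

lemma ex_countable_determining_functions:
  obtains f :: "nat \<Rightarrow> 'a::{metric_space, second_countable_topology} \<Rightarrow> real"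
  where "\<And>n. continuous_on UNIV (f n)" "\<And>n. bounded (range (f n))"
    "\<And>P Q. P \<in> space (prob_algebra borel) \<Longrightarrow> Q \<in> space (prob_algebra borel) \<Longrightarrow>
       (\<And>n. (\<integral>x. f n x \<partial>P) = (\<integral>x. f n x \<partial>Q)) \<Longrightarrow> P = Q"
proof -
  obtain B :: "'a set set" where B: "countable B" "topological_basis B"
    using ex_countable_basis by blast
  define E where "E = Inter ` {F. finite F \<and> F \<subseteq> B}"
  have cE: "countable E"
    unfolding E_def by (intro countable_image countable_Collect_finite_subset B)
  \<comment> \<open>The empty intersection puts \<open>UNIV\<close> into \<open>E\<close>. This
    makes \<open>E\<close> nonempty for the enumeration and supplies the exhausting sequence in the
    uniqueness theorem at the end.\<close>
  have UE: "UNIV \<in> E" unfolding E_def by (auto intro!: image_eqI[of _ _ "{}"])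
  have BE: "B \<subseteq> E" unfolding E_def by (intro subsetI image_eqI[where x = "{_}"]) auto
  have oE: "open X" if X: "X \<in> E" for X
  proof -
    obtain F where F: "X = \<Inter>F" "F \<in> {F. finite F \<and> F \<subseteq> B}"
      using X unfolding E_def by (rule imageE)
    then show ?thesis unfolding F(1) using topological_basis_open[OF B(2)]
      by (intro open_Inter) auto
  qed
  have "Int_stable E"
  proof (rule Int_stableI)
    fix X Y assume "X \<in> E" "Y \<in> E"
    obtain F where F: "X = \<Inter>F" "F \<in> {F. finite F \<and> F \<subseteq> B}"
      using \<open>X \<in> E\<close> unfolding E_def by (rule imageE)
    obtain G where G: "Y = \<Inter>G" "G \<in> {F. finite F \<and> F \<subseteq> B}"
      using \<open>Y \<in> E\<close> unfolding E_def by (rule imageE)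
    have "X \<inter> Y = \<Inter>(F \<union> G)" using F(1) G(1) by (simp add: Inter_Un_distrib)
    moreover have "F \<union> G \<in> {F. finite F \<and> F \<subseteq> B}" using F(2) G(2) by simp
    ultimately show "X \<inter> Y \<in> E" unfolding E_def by (rule image_eqI)
  qed
  have "sigma_sets UNIV E = sets (borel :: 'a measure)"
  proof (rule antisym)
    show "sigma_sets UNIV E \<subseteq> sets borel"
      using sets.sigma_sets_subset[of E "borel :: 'a measure"] oE by (simp add: subsetI)
    have "sets (borel :: 'a measure) = sigma_sets UNIV B"
      by (subst borel_eq_countable_basis[OF B]) simp
    also have "\<dots> \<subseteq> sigma_sets UNIV E" by (rule sigma_sets_mono') (rule BE)
    finally show "sets borel \<subseteq> sigma_sets UNIV E" .
  qed
  define U where "U = from_nat_into E"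
  have rU: "range U = E" unfolding U_def using cE UE by (intro range_from_nat_into) auto
  \<comment> \<open>Decoding \<open>n\<close> as \<open>(i, k)\<close> gives the ramp of slope
    \<open>k\<close> for the set \<open>U i\<close>.\<close>
  define f :: "nat \<Rightarrow> 'a \<Rightarrow> real"
    where "f n x = min 1 (real (snd (prod_decode n)) * infdist x (- U (fst (prod_decode n))))" for n x
  show thesis
  proof (rule that[of f])
    show "continuous_on UNIV (f n)" for n
      unfolding f_def by (intro continuous_intros)
    have "norm (f n x) \<le> 1" for n x unfolding f_def by (simp add: infdist_nonneg)
    then show "bounded (range (f n))" for n by (intro boundedI[of _ 1]) auto
  next
    fix P Q :: "'a measure"
    assume P: "P \<in> space (prob_algebra borel)" and Q: "Q \<in> space (prob_algebra borel)"
      and eq: "\<And>n. (\<integral>x. f n x \<partial>P) = (\<integral>x. f n x \<partial>Q)"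
    interpret P: prob_space P using P by (simp add: space_prob_algebra)
    interpret Q: prob_space Q using Q by (simp add: space_prob_algebra)
    have sP: "sets P = sets borel" and sQ: "sets Q = sets borel"
      using P Q by (auto simp: space_prob_algebra)
    \<comment> \<open>For \<open>X = UNIV\<close> the ramps vanish identically and carry no
      information; there the total masses, both 1, agree.\<close>
    have emeq: "emeasure P X = emeasure Q X" if "X \<in> E" for X
    proof (cases "X = UNIV")
      case True
      then show ?thesis
        using P.emeasure_space_1 Q.emeasure_space_1
          sets_eq_imp_space_eq[OF sP] sets_eq_imp_space_eq[OF sQ] by simp
    next
      case False
      obtain i where i: "X = U i" using \<open>X \<in> E\<close> rU by auto
      have "(\<integral>x. min 1 (real k * infdist x (- X)) \<partial>P) = (\<integral>x. min 1 (real k * infdist x (- X)) \<partial>Q)" for k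
        using eq[of "prod_encode (i, k)"] unfolding f_def i by simp
      then have "measure P X = measure Q X"
        using integral_infdist_tendsto_measure[OF P oE[OF that] False]
          integral_infdist_tendsto_measure[OF Q oE[OF that] False]
        by (auto intro: LIMSEQ_unique)
      then show ?thesis by (simp add: P.emeasure_eq_measure Q.emeasure_eq_measure)
    qed
    show "P = Q"
      by (rule measure_eqI_generator_eq[where E = E and \<Omega> = UNIV and A = "\<lambda>_. UNIV"])
        (use \<open>Int_stable E\<close> emeq sP sQ \<open>sigma_sets UNIV E = sets borel\<close> UE in auto)
  qed
qed

section \<open>Compactness in the weak topology\<close>

lemma topspace_weak_topology: "topspace weak_topology = space (prob_algebra borel)"
proof
  show "topspace weak_topology \<subseteq> space (prob_algebra borel)"
    unfolding weak_topology_def topology_generated_by_topspace by auto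
  \<comment> \<open>The zero function with \<open>U = UNIV\<close> exhibits the whole space as a
    subbasic open set.\<close>
  have "space (prob_algebra borel) \<in> {{P \<in> space (prob_algebra borel). (\<integral>x. f x \<partial>P) \<in> U} |
      (f :: 'a \<Rightarrow> real) U. continuous_on UNIV f \<and> bounded (range f) \<and> open U}"
    by (intro CollectI exI[of _ "\<lambda>_. 0"] exI[of _ UNIV]) auto
  then show "space (prob_algebra borel) \<subseteq> topspace (weak_topology :: 'a measure topology)"
    unfolding weak_topology_def topology_generated_by_topspace by auto
qed

lemma continuous_map_integral_weak_topology:
  fixes f :: "'a::topological_space \<Rightarrow> real"
  assumes "continuous_on UNIV f" "bounded (range f)"
  shows "continuous_map weak_topology euclideanreal (\<lambda>P. \<integral>x. f x \<partial>P)"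
  unfolding continuous_map topspace_weak_topology
proof (intro conjI allI impI)
  fix U :: "real set" assume "openin euclideanreal U"
  then show "openin weak_topology {P \<in> space (prob_algebra borel). (\<integral>x. f x \<partial>P) \<in> U}"
    unfolding weak_topology_def using assms by (intro topology_generated_by_Basis) auto
qed simp

text \<open>The sets where the partial sum over the indices below \<open>k\<close> exceeds
  \<open>1 / Suc k\<close> are open, cover \<open>\<P>\<close> and increase with \<open>k\<close>,
  so by compactness a single one of them contains \<open>\<P>\<close>.\<close>

lemma finite_separation_from_compactin:
  fixes \<P> :: "'a::topological_space measure set" and f :: "nat \<Rightarrow> 'a \<Rightarrow> real"
  assumes comp: "compactin weak_topology \<P>"
    and f: "\<And>n. continuous_on UNIV (f n)" "\<And>n. bounded (range (f n))"
    and sep: "\<And>P. P \<in> \<P> \<Longrightarrow> \<exists>n. (\<integral>x. f n x \<partial>P) \<noteq> v n"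
  obtains N d where "d > 0" "\<And>P. P \<in> \<P> \<Longrightarrow> d \<le> (\<Sum>n<N. ((\<integral>x. f n x \<partial>P) - v n)\<^sup>2)"
proof -
  have cont: "continuous_map weak_topology euclideanreal (\<lambda>P. \<integral>x. f n x \<partial>P)" for n
    by (rule continuous_map_integral_weak_topology) (fact f)+
  define W where "W N d = {P \<in> topspace weak_topology. (\<Sum>n<N. ((\<integral>x. f n x \<partial>P) - v n)\<^sup>2) \<in> {d<..}}"
    for N d
  have "openin weak_topology (W N d)" for N d
    unfolding W_def
    by (rule openin_continuous_map_preimage[where Y = euclideanreal])
       (auto intro!: continuous_intros cont)
  moreover have "\<P> \<subseteq> \<Union> (range (\<lambda>k. W k (1 / real (Suc k))))"
  proof
    fix P assume P: "P \<in> \<P>"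
    obtain n where n: "(\<integral>x. f n x \<partial>P) \<noteq> v n" using sep[OF P] by blast
    define s where "s = ((\<integral>x. f n x \<partial>P) - v n)\<^sup>2"
    have "s > 0" using n by (simp add: s_def)
    then obtain j where j: "1 / real (Suc j) < s" by (metis inverse_eq_divide reals_Archimedean)
    \<comment> \<open>\<open>Suc n\<close> brings the index \<open>n\<close> into the sum over
      indices below \<open>k\<close>; \<open>j\<close> brings the threshold \<open>1 / Suc k\<close>
      below \<open>s\<close>.\<close>
    define k where "k = max (Suc n) j"
    have "1 / real (Suc k) \<le> 1 / real (Suc j)" by (simp add: k_def field_simps)
    moreover have "s \<le> (\<Sum>n<k. ((\<integral>x. f n x \<partial>P) - v n)\<^sup>2)"
      unfolding s_def by (rule member_le_sum) (auto simp: k_def)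
    moreover have "P \<in> topspace weak_topology" using P comp by (auto simp: compactin_def)
    ultimately have "P \<in> W k (1 / real (Suc k))" using j by (simp add: W_def)
    then show "P \<in> \<Union> (range (\<lambda>k. W k (1 / real (Suc k))))" by blast
  qed
  ultimately obtain \<F> where \<F>: "finite \<F>" "\<F> \<subseteq> range (\<lambda>k. W k (1 / real (Suc k)))" "\<P> \<subseteq> \<Union>\<F>"
    using comp unfolding compactin_def by (metis (no_types, lifting) imageE)
  then obtain K where K: "finite K" "\<F> = (\<lambda>k. W k (1 / real (Suc k))) ` K"
    by (meson finite_subset_image)
  obtain N where N: "\<And>k. k \<in> K \<Longrightarrow> k \<le> N" using K(1) finite_nat_set_iff_bounded_le by auto
  show thesis
  proof (rule that[of "1 / real (Suc N)" N])
    fix P assume "P \<in> \<P>"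
    then obtain k where k: "k \<in> K" "P \<in> W k (1 / real (Suc k))" using \<F> K by auto
    have "1 / real (Suc N) \<le> 1 / real (Suc k)" using N[OF k(1)] by (simp add: field_simps)
    also have "\<dots> \<le> (\<Sum>n<k. ((\<integral>x. f n x \<partial>P) - v n)\<^sup>2)" using k(2) by (simp add: W_def)
    also have "\<dots> \<le> (\<Sum>n<N. ((\<integral>x. f n x \<partial>P) - v n)\<^sup>2)"
      using N[OF k(1)] by (intro sum_mono2) auto
    finally show "1 / real (Suc N) \<le> (\<Sum>n<N. ((\<integral>x. f n x \<partial>P) - v n)\<^sup>2)" .
  qed simp
qed

section \<open>Quadratic certificates\<close>

text \<open>Rational parameters leave countably many certificates for a given \<open>f\<close>. With
  the kernel written as a product over \<open>j<2\<close>, symmetry is a permutation of factors and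
  the integral factorises over the coordinates.\<close>

definition quadratic_certificate ::
    "(nat \<Rightarrow> 'a \<Rightarrow> real) \<Rightarrow> rat list \<Rightarrow> rat \<Rightarrow> (nat \<Rightarrow> 'a) \<Rightarrow> real" where
  "quadratic_certificate f q c x =
     of_rat c - (\<Sum>i<length q. \<Prod>j<2. f i (x j) - of_rat (q ! i))"

lemma bounded_continuous_quadratic_certificate:
  assumes f: "\<And>n. continuous_on UNIV (f n)" "\<And>n. bounded (range (f n))"
  shows "bounded_continuous_on_power 2 (quadratic_certificate f q c)"
  unfolding bounded_continuous_on_power_def
proof
  have "continuous_map (product_topology (\<lambda>_. euclidean) {..<2}) euclideanreal (\<lambda>x. f i (x j))"
    if "j \<in> {..<2}" for i and j :: nat
    using continuous_map_compose[OF continuous_map_product_projection[OF that],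
        of "\<lambda>_. euclidean" euclideanreal "f i"] f(1) by (simp add: o_def)
  then show "continuous_map (product_topology (\<lambda>_. euclidean) {..<2}) euclideanreal
      (quadratic_certificate f q c)"
    unfolding quadratic_certificate_def by (intro continuous_intros) auto
  obtain B where B: "\<And>n x. \<bar>f n x\<bar> \<le> B n"
    using f(2) unfolding bounded_iff by (metis rangeI real_norm_def)
  have "\<bar>quadratic_certificate f q c x\<bar> \<le>
      \<bar>of_rat c\<bar> + (\<Sum>i<length q. \<Prod>j<(2::nat). B i + \<bar>of_rat (q ! i)\<bar>)" for x
  proof -
    have "\<bar>\<Sum>i<length q. \<Prod>j<2. f i (x j) - of_rat (q ! i)\<bar> \<le>
        (\<Sum>i<length q. \<bar>\<Prod>j<2. f i (x j) - of_rat (q ! i)\<bar>)" by (rule sum_abs)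
    also have "\<dots> \<le> (\<Sum>i<length q. \<Prod>j<(2::nat). B i + \<bar>of_rat (q ! i)\<bar>)"
      unfolding abs_prod
    proof (intro sum_mono prod_mono conjI)
      fix i j show "\<bar>f i (x j) - of_rat (q ! i)\<bar> \<le> B i + \<bar>of_rat (q ! i)\<bar>"
        using B[of i "x j"] by linarith
    qed simp
    finally show ?thesis unfolding quadratic_certificate_def by linarith
  qed
  then show "bounded (quadratic_certificate f q c ` ({..<2} \<rightarrow>\<^sub>E UNIV))"
    by (intro boundedI) auto
qed

lemma symmetric_quadratic_certificate: "symmetric_on_power 2 (quadratic_certificate f q c)"
  unfolding symmetric_on_power_def
proof (intro allI impI ballI)
  fix \<pi> :: "nat \<Rightarrow> nat" and x :: "nat \<Rightarrow> 'a"
  assume "\<pi> permutes {..<2}"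
  then have "(\<Prod>j<2. f i (x (\<pi> j)) - of_rat (q ! i)) = (\<Prod>j<2. f i (x j) - of_rat (q ! i))" for i
    by (rule prod.permute[symmetric, unfolded o_def])
  then show "quadratic_certificate f q c (\<lambda>i. x (\<pi> i)) = quadratic_certificate f q c x"
    unfolding quadratic_certificate_def by simp
qed

lemma measurable_quadratic_certificate:
  assumes "\<And>n. continuous_on UNIV (f n)"
  shows "quadratic_certificate f q c \<in> borel_measurable (iid_power 2 borel)"
proof -
  have [measurable]: "f n \<in> borel_measurable borel" for n
    using assms by (rule borel_measurable_continuous_onI)
  show ?thesis unfolding quadratic_certificate_def by measurable
qed

text \<open>The two coordinates are independent with the same law, so each kernel integrates to a
  squared mean. Hence the expectation is positive exactly when the mean vector of \<open>R\<close>
  is at squared distance less than \<open>c\<close> from \<open>q\<close>.\<close>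

lemma integral_quadratic_certificate:
  assumes f: "\<And>n. continuous_on UNIV (f n)" "\<And>n. bounded (range (f n))"
    and R: "R \<in> space (prob_algebra borel)"
  shows "(\<integral>x. quadratic_certificate f q c x \<partial>iid_power 2 R) =
    of_rat c - (\<Sum>i<length q. ((\<integral>x. f i x \<partial>R) - of_rat (q ! i))\<^sup>2)"
proof -
  interpret R: prob_space R using R by (simp add: space_prob_algebra)
  interpret product_prob_space "\<lambda>_::nat. R" "{..<2::nat}" by unfold_locales
  have sP[measurable_cong]: "sets R = sets borel" using R by (simp add: space_prob_algebra)
  have [measurable]: "f n \<in> borel_measurable R" for n
    using borel_measurable_continuous_onI[OF f(1)] by measurable
  have int: "integrable R (f n)" for n
  proof -
    obtain B where "\<And>x. norm (f n x) \<le> B" using f(2)[of n] unfolding bounded_iff by auto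
    then show ?thesis by (intro R.integrable_const_bound[of _ B]) auto
  qed
  have prod_int: "(\<integral>x. (\<Prod>j<2. f i (x j) - a) \<partial>iid_power 2 R) = ((\<integral>x. f i x \<partial>R) - a)\<^sup>2"
    "integrable (iid_power 2 R) (\<lambda>x. \<Prod>j<2. f i (x j) - a)" for i and a :: real
    using int by (subst product_integral_prod product_integrable_prod; simp add: R.prob_space)+
  show ?thesis
    unfolding quadratic_certificate_def
    by (subst Bochner_Integration.integral_diff)
       (auto simp: prod_int P.prob_space)
qed

section \<open>Concentration of block sums\<close>

text \<open>Disjoint blocks of length \<open>n\<close> are independent with law
  \<open>iid_power n R\<close>, so \<open>S\<close> is a sum of \<open>N\<close> independent terms
  with values in \<open>{- B..B}\<close> and mean \<mu>. Both bounds are Hoeffding's inequality for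
  the deviation \<open>N * \<epsilon>\<close>.\<close>

lemma hoeffding_blocks:
  fixes R :: "'a::topological_space measure" and h :: "(nat \<Rightarrow> 'a) \<Rightarrow> real"
  assumes R: "R \<in> space (prob_algebra borel)"
    and h: "h \<in> borel_measurable (iid_power n borel)"
    and B: "\<And>x. x \<in> space (iid_power n borel) \<Longrightarrow> \<bar>h x\<bar> \<le> B" "0 < B"
    and "0 < N" "0 \<le> \<epsilon>"
  defines "S \<equiv> \<lambda>\<omega>. \<Sum>j<N. h (\<lambda>i\<in>{..<n}. \<omega> (j * n + i))"
    and "\<mu> \<equiv> \<integral>x. h x \<partial>iid_power n R"
  shows "measure (iid_seq R) {\<omega>. real N * (\<mu> + \<epsilon>) \<le> S \<omega>} \<le> exp (- (real N * \<epsilon>\<^sup>2 / (2 * B\<^sup>2)))"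
    and "measure (iid_seq R) {\<omega>. S \<omega> \<le> real N * (\<mu> - \<epsilon>)} \<le> exp (- (real N * \<epsilon>\<^sup>2 / (2 * B\<^sup>2)))"
proof -
  interpret R: prob_space R using R by (simp add: space_prob_algebra)
  interpret product_prob_space "\<lambda>_::nat. R" UNIV by unfold_locales
  have sR[measurable_cong]: "sets R = sets borel" using R by (simp add: space_prob_algebra)
  have spR: "space R = UNIV" using sets_eq_imp_space_eq[OF sR] by simp
  have sRn: "sets (iid_power n R) = sets (iid_power n borel)" by (intro sets_PiM_cong) (auto simp: sR)
  have h'[measurable]: "h \<in> borel_measurable (iid_power n R)"
    using h by (simp add: measurable_cong_sets[OF sRn refl])
  define X where "X j \<omega> = h (\<lambda>i\<in>{..<n}. \<omega> (j * n + i))" for j and \<omega> :: "nat \<Rightarrow> 'a"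
  have meas_block: "(\<lambda>\<omega>. \<lambda>i\<in>{..<n}. \<omega> (j * n + i)) \<in> iid_seq R \<rightarrow>\<^sub>M iid_power n R" for j
    by (intro measurable_restrict measurable_component_singleton) auto
  \<comment> \<open>A block is an injective reindexing of the coordinates, and such a reindexing
    carries the product law to the product law.\<close>
  have distr: "distr (iid_seq R) (iid_power n R) (\<lambda>\<omega>. \<lambda>i\<in>{..<n}. \<omega> (j * n + i)) = iid_power n R" for j
    by (rule distr_PiM_reindex[where M = "\<lambda>_. R" and K = UNIV])
       (auto simp: inj_on_def R.prob_space_axioms)
  have EX: "P.expectation (X j) = \<mu>" for j
    unfolding \<mu>_def X_def by (subst distr[of j, symmetric], subst integral_distr[OF meas_block h']) simp
  \<comment> \<open>Independence of the coordinates means that their joint law is the product of the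
    marginals; here the joint map is the identity.\<close>
  have "P.indep_vars (\<lambda>_. R) (\<lambda>i \<omega>. \<omega> i) UNIV"
    by (subst P.indep_vars_iff_distr_eq_PiM')
       (auto intro!: measurable_component_singleton simp: distr_id2 PiM_component restrict_def)
  then have "P.indep_vars (\<lambda>j. Pi\<^sub>M {j * n..<j * n + n} (\<lambda>_. R))
      (\<lambda>j \<omega>. restrict (\<lambda>i. \<omega> i) {j * n..<j * n + n}) UNIV"
  proof (rule P.indep_vars_restrict)
    show "disjoint_family_on (\<lambda>j. {j * n..<j * n + n}) UNIV"
      unfolding disjoint_family_on_def
    proof (intro ballI impI)
      fix j k :: nat assume "j \<noteq> k"
      have "j * n + n \<le> k * n" if "j < k" for j k :: nat
        using that mult_le_mono1[of "Suc j" k n] by simp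
      then show "{j * n..<j * n + n} \<inter> {k * n..<k * n + n} = {}"
        using \<open>j \<noteq> k\<close> by (cases "j < k") force+
    qed
  qed auto
  then have "P.indep_vars (\<lambda>_. borel)
      (\<lambda>j \<omega>. h (\<lambda>i\<in>{..<n}. restrict (\<lambda>i. \<omega> i) {j * n..<j * n + n} (j * n + i))) UNIV"
  proof (rule P.indep_vars_compose2)
    fix j :: nat
    have "(\<lambda>\<omega>. \<lambda>i\<in>{..<n}. \<omega> (j * n + i)) \<in> Pi\<^sub>M {j * n..<j * n + n} (\<lambda>_. R) \<rightarrow>\<^sub>M iid_power n R"
      by (intro measurable_restrict measurable_component_singleton) auto
    then show "(\<lambda>\<omega>. h (\<lambda>i\<in>{..<n}. \<omega> (j * n + i))) \<in> borel_measurable (Pi\<^sub>M {j * n..<j * n + n} (\<lambda>_. R))"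
      by (rule measurable_compose) (rule h')
  qed
  \<comment> \<open>Block \<open>j\<close> reads only indices in its own interval, so restricting to
    that interval first changes nothing.\<close>
  moreover have "(\<lambda>i\<in>{..<n}. restrict (\<lambda>i. \<omega> i) {j * n..<j * n + n} (j * n + i)) =
      (\<lambda>i\<in>{..<n}. \<omega> (j * n + i))" for \<omega> :: "nat \<Rightarrow> 'a" and j
    by (auto simp: restrict_def)
  ultimately have indep: "P.indep_vars (\<lambda>_. borel) X UNIV"
    unfolding X_def by simp
  interpret H: Hoeffding_ineq "iid_seq R" "{..<N}" X "\<lambda>_. - B" "\<lambda>_. B" "real N * \<mu>"
  proof unfold_locales
    show "P.indep_vars (\<lambda>_. borel) X {..<N}" by (rule P.indep_vars_subset[OF indep]) simp
    have "\<bar>X j \<omega>\<bar> \<le> B" for j \<omega>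
      unfolding X_def by (rule B(1)) (simp add: space_PiM)
    then show "AE \<omega> in iid_seq R. X j \<omega> \<in> {- B..B}" for j
      by (intro AE_I2) (auto simp: abs_le_iff minus_le_iff)
    show "real N * \<mu> \<equiv> \<Sum>j<N. P.expectation (X j)" by (simp add: EX)
  qed simp
  \<comment> \<open>Each term ranges over an interval of width \<open>2 * B\<close>; this gives the
    denominator in Hoeffding's exponent.\<close>
  have var: "(\<Sum>j<N. (B - - B)\<^sup>2) = 4 * real N * B\<^sup>2" by (simp add: power2_eq_square)
  have exponent: "-2 * (real N * \<epsilon>)\<^sup>2 / (4 * real N * B\<^sup>2) = - (real N * \<epsilon>\<^sup>2 / (2 * B\<^sup>2))"
    using \<open>0 < N\<close> \<open>0 < B\<close> by (simp add: field_simps power2_eq_square)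
  have sp: "space (iid_seq R) = UNIV" by (simp add: space_PiM spR)
  have pos: "(\<Sum>j<N. (B - - B)\<^sup>2) > 0" unfolding var using \<open>0 < N\<close> \<open>0 < B\<close> by simp
  have "0 \<le> real N * \<epsilon>" using \<open>0 \<le> \<epsilon>\<close> by simp
  note ineqs = H.Hoeffding_ineq_ge[OF this pos, unfolded var exponent sp]
    H.Hoeffding_ineq_le[OF this pos, unfolded var exponent sp]
  then show "measure (iid_seq R) {\<omega>. real N * (\<mu> + \<epsilon>) \<le> S \<omega>} \<le> exp (- (real N * \<epsilon>\<^sup>2 / (2 * B\<^sup>2)))"
    "measure (iid_seq R) {\<omega>. S \<omega> \<le> real N * (\<mu> - \<epsilon>)} \<le> exp (- (real N * \<epsilon>\<^sup>2 / (2 * B\<^sup>2)))"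
    by (simp_all add: S_def X_def distrib_left right_diff_distrib)
qed

section \<open>Sequential tests from certificates\<close>

lemma measurable_coord_filtration:
  assumes "enat i < t"
  shows "(\<lambda>\<omega>. \<omega> i) \<in> coord_filtration t \<rightarrow>\<^sub>M (borel :: 'a::topological_space measure)"
  unfolding coord_filtration_def using assms
  by (intro measurableI) (auto intro!: sigma_sets.Basic simp: sets_measure_of_conv space_measure_of_conv)

lemma sets_coord_filtration_mono:
  assumes "s \<le> t"
  shows "sets (coord_filtration s :: (nat \<Rightarrow> 'a::topological_space) measure)
    \<subseteq> sets (coord_filtration t)"
proof -
  have "{(\<lambda>\<omega>. \<omega> i) -` A | i A. enat i < s \<and> A \<in> sets borel}
      \<subseteq> {(\<lambda>\<omega>. \<omega> i) -` A | i A. enat i < t \<and> A \<in> sets (borel :: 'a measure)}"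
    using order_less_le_trans[OF _ assms] by blast
  from sigma_sets_mono'[OF this] show ?thesis
    unfolding coord_filtration_def by (simp add: sets_measure_of_conv)
qed

lemma sets_coord_filtration_subset:
  "sets (coord_filtration t) \<subseteq> sets (iid_seq (borel :: 'a::topological_space measure))"
proof -
  have "(\<lambda>\<omega>. \<omega> i) -` A \<in> sets (iid_seq (borel :: 'a measure))" if "A \<in> sets borel" for i A
    using measurable_sets[OF measurable_component_singleton[of i UNIV "\<lambda>_. borel"] that]
    by (simp add: space_PiM)
  then have "{(\<lambda>\<omega>. \<omega> i) -` A | i A. enat i < t \<and> A \<in> sets (borel :: 'a measure)}
      \<subseteq> sets (iid_seq (borel :: 'a measure))" by auto
  from sets.sigma_sets_subset[OF this] show ?thesis
    unfolding coord_filtration_def by (simp add: sets_measure_of_conv space_PiM)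
qed

text \<open>The event is that the average of \<open>h\<close> over \<open>N\<close> blocks is at
  least \<epsilon>, midway between the means 0 and \<open>2 * \<epsilon>\<close>. Either error then
  requires a deviation of at least \<epsilon>, which Hoeffding's inequality makes unlikely. The
  number of blocks depends on the bound of \<open>h\<close>, \<epsilon> and \<delta> only, so one
  event serves all \<open>R\<close>.\<close>

lemma ex_block_event:
  fixes h :: "(nat \<Rightarrow> 'a::topological_space) \<Rightarrow> real"
  assumes h: "h \<in> borel_measurable (iid_power n borel)" "bounded (h ` space (iid_power n borel))"
    and "1 \<le> n" "0 < \<epsilon>" "0 < \<delta>"
  shows "\<exists>k A. 1 \<le> k \<and> A \<in> sets (coord_filtration (enat k)) \<and>
    (\<forall>R\<in>space (prob_algebra borel). (\<integral>x. h x \<partial>iid_power n R) \<le> 0 \<longrightarrow> measure (iid_seq R) A \<le> \<delta>) \<and>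
    (\<forall>R\<in>space (prob_algebra borel). 2 * \<epsilon> \<le> (\<integral>x. h x \<partial>iid_power n R) \<longrightarrow>
       1 - \<delta> \<le> measure (iid_seq R) A)"
proof -
  obtain B where B: "0 < B" "\<And>x. x \<in> space (iid_power n borel) \<Longrightarrow> \<bar>h x\<bar> \<le> B"
    using h(2) unfolding bounded_pos by auto
  define c where "c = \<epsilon>\<^sup>2 / (2 * B\<^sup>2)"
  have "c > 0" using B(1) \<open>0 < \<epsilon>\<close> by (simp add: c_def)
  \<comment> \<open>Exceeding \<open>- ln \<delta>\<close> makes the Hoeffding bound at most
    \<delta>; exceeding 1 forces \<open>N\<close> to be positive even when \<delta> is at least
    1.\<close>
  then obtain N :: nat where "max 1 (- ln \<delta>) < real N * c"
    using reals_Archimedean3 by blast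
  then have Nc: "1 < real N * c" "- ln \<delta> < real N * c" by auto
  have N: "0 < N" using Nc(1) by (cases N) auto
  have "exp (- (real N * c)) \<le> exp (ln \<delta>)" using Nc(2) by simp
  then have N\<delta>: "exp (- (real N * \<epsilon>\<^sup>2 / (2 * B\<^sup>2))) \<le> \<delta>"
    using \<open>0 < \<delta>\<close> by (simp add: c_def)
  define S where "S \<omega> = (\<Sum>j<N. h (\<lambda>i\<in>{..<n}. \<omega> (j * n + i)))" for \<omega>
  define A where "A = {\<omega>. real N * \<epsilon> \<le> S \<omega>}"
  have S_meas: "S \<in> borel_measurable (coord_filtration (enat (N * n)))"
    unfolding S_def
  proof (rule borel_measurable_sum)
    fix j assume "j \<in> {..<N}"
    \<comment> \<open>Time \<open>t\<close> reveals the coordinates with index below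
      \<open>t\<close>, and block \<open>j\<close> uses indices below \<open>Suc j * n\<close>. So
      \<open>S\<close> is known at time \<open>N * n\<close>.\<close>
    then have "Suc j * n \<le> N * n" by (intro mult_le_mono1) auto
    then have "(\<lambda>\<omega>. \<lambda>i\<in>{..<n}. \<omega> (j * n + i))
        \<in> coord_filtration (enat (N * n)) \<rightarrow>\<^sub>M iid_power n borel"
      by (intro measurable_restrict measurable_coord_filtration) auto
    then show "(\<lambda>\<omega>. h (\<lambda>i\<in>{..<n}. \<omega> (j * n + i))) \<in> borel_measurable (coord_filtration (enat (N * n)))"
      by (rule measurable_compose) (rule h(1))
  qed
  have "space (coord_filtration t :: (nat \<Rightarrow> 'a) measure) = UNIV" for t
    by (simp add: coord_filtration_def space_measure_of_conv)
  then have S_sets: "{\<omega>. a \<le> S \<omega>} \<in> sets (coord_filtration (enat (N * n)))"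
    "{\<omega>. S \<omega> \<le> a} \<in> sets (coord_filtration (enat (N * n)))" for a
    using S_meas[unfolded borel_measurable_iff_ge] S_meas[unfolded borel_measurable_iff_le] by simp_all
  then have A: "A \<in> sets (coord_filtration (enat (N * n)))"
    unfolding A_def by simp
  show ?thesis
  proof (intro exI conjI ballI impI)
    show "1 \<le> N * n" using N \<open>1 \<le> n\<close> by simp
    show "A \<in> sets (coord_filtration (enat (N * n)))" by fact
  next
    fix R :: "'a measure" assume R: "R \<in> space (prob_algebra borel)"
    interpret R: prob_space R using R by (simp add: space_prob_algebra)
    interpret product_prob_space "\<lambda>_::nat. R" UNIV by unfold_locales
    have sR: "sets R = sets borel" using R by (simp add: space_prob_algebra)
    have "sets (iid_seq R) = sets (iid_seq borel)" by (intro sets_PiM_cong) (auto simp: sR)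
    then have sets_seq: "X \<in> sets (iid_seq R)" if "X \<in> sets (coord_filtration t)" for X t
      using that sets_coord_filtration_subset by blast
    have spc: "space (iid_seq R) = UNIV"
      using sets_eq_imp_space_eq[OF sR] by (simp add: space_PiM)
    note hoeffding = hoeffding_blocks[OF R h(1) B(2,1) N less_imp_le[OF \<open>0 < \<epsilon>\<close>], folded S_def]
    define \<mu> where "\<mu> = (\<integral>x. h x \<partial>iid_power n R)"
    show "measure (iid_seq R) A \<le> \<delta>" if "(\<integral>x. h x \<partial>iid_power n R) \<le> 0"
    proof -
      \<comment> \<open>With \<mu> at most 0, the event \<open>A\<close> lies inside the upper
        deviation event.\<close>
      have "real N * (\<mu> + \<epsilon>) \<le> real N * \<epsilon>"
        using that by (intro mult_left_mono) (auto simp: \<mu>_def)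
      then have "measure (iid_seq R) A \<le> measure (iid_seq R) {\<omega>. real N * (\<mu> + \<epsilon>) \<le> S \<omega>}"
        unfolding A_def by (intro P.finite_measure_mono sets_seq[OF S_sets(1)]) auto
      then show ?thesis using hoeffding(1) N\<delta> by (simp add: \<mu>_def)
    qed
    show "1 - \<delta> \<le> measure (iid_seq R) A" if "2 * \<epsilon> \<le> (\<integral>x. h x \<partial>iid_power n R)"
    proof -
      \<comment> \<open>With \<mu> at least \<open>2 * \<epsilon>\<close>, the complement of
        \<open>A\<close> lies inside the lower deviation event.\<close>
      have "real N * \<epsilon> \<le> real N * (\<mu> - \<epsilon>)"
        using that by (intro mult_left_mono) (auto simp: \<mu>_def)
      then have "measure (iid_seq R) (UNIV - A) \<le> measure (iid_seq R) {\<omega>. S \<omega> \<le> real N * (\<mu> - \<epsilon>)}"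
        unfolding A_def by (intro P.finite_measure_mono sets_seq[OF S_sets(2)]) auto
      then have "measure (iid_seq R) (UNIV - A) \<le> \<delta>" using hoeffding(2) N\<delta> by (simp add: \<mu>_def)
      then show ?thesis using P.prob_compl[OF sets_seq[OF A]] by (simp add: spc)
    qed
  qed
qed

text \<open>The test stops at the least decision time \<open>k i\<close> among the events
  \<open>A i\<close> that occur. If none occurs, the infimum over the empty set is infinite and the
  test never stops.\<close>

lemma sequential_test_of_events:
  fixes A :: "nat \<Rightarrow> (nat \<Rightarrow> 'a::topological_space) set"
  assumes A: "\<And>i. A i \<in> sets (coord_filtration (enat (k i)))" and k: "\<And>i. 1 \<le> k i"
  obtains \<tau> where "sequential_test \<tau>" "{\<omega>. \<tau> \<omega> < \<infinity>} = (\<Union>i. A i)"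
proof
  define T where "T \<omega> = (INF i\<in>{i. \<omega> \<in> A i}. enat (k i))" for \<omega>
  have T_le: "T \<omega> \<le> enat t \<longleftrightarrow> (\<exists>i. \<omega> \<in> A i \<and> k i \<le> t)" for \<omega> t
  proof
    assume "T \<omega> \<le> enat t"
    \<comment> \<open>An infimum strictly below a bound has a member of the family below that bound;
      passing to \<open>Suc t\<close> makes the inequality strict.\<close>
    then have "T \<omega> < enat (Suc t)" by (simp add: order_le_less_trans)
    then show "\<exists>i. \<omega> \<in> A i \<and> k i \<le> t" unfolding T_def by (auto simp: INF_less_iff)
  next
    assume "\<exists>i. \<omega> \<in> A i \<and> k i \<le> t"
    then show "T \<omega> \<le> enat t" unfolding T_def by (auto intro!: INF_lower2)
  qed
  have "Measurable.pred (coord_filtration t) (\<lambda>\<omega>. T \<omega> \<le> t)" for t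
  proof (cases t)
    case (enat s)
    have "(\<Union>i\<in>{i. k i \<le> s}. A i) \<in> sets (coord_filtration (enat s))"
      using A sets_coord_filtration_mono[of "enat (k _)" "enat s"] by (intro sets.countable_UN') auto
    moreover have "{\<omega>. T \<omega> \<le> t} = (\<Union>i\<in>{i. k i \<le> s}. A i)"
      using T_le enat by auto
    ultimately show ?thesis
      by (simp add: pred_def enat coord_filtration_def space_measure_of_conv)
  qed simp
  moreover have "1 \<le> T \<omega>" for \<omega>
    unfolding T_def using k by (auto intro!: INF_greatest simp: one_enat_def)
  ultimately show "sequential_test T"
    unfolding sequential_test_def stopping_time_def by blast
  have "T \<omega> < \<infinity> \<longleftrightarrow> (\<exists>i. \<omega> \<in> A i)" for \<omega>
    unfolding T_def INF_less_iff by simp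
  then show "{\<omega>. T \<omega> < \<infinity>} = (\<Union>i. A i)" by auto
qed

text \<open>Every pair (certificate, precision) is tried infinitely often, with error probabilities
  that sum to \<open>\<alpha>\<close>: the sum bounds the level, and the errors tending to 0 give power one.\<close>

lemma testable_at_level_of_certifying_family:
  fixes \<P> \<Q> :: "'a::topological_space measure set"
  assumes cert: "certifying_family \<P> \<Q> n h"
    and sub: "\<P> \<subseteq> space (prob_algebra borel)" "\<Q> \<subseteq> space (prob_algebra borel)"
    and "0 < \<alpha>"
  shows "testable_at_level \<alpha> \<P> \<Q>"
proof -
  define m where "m i = fst (prod_decode (fst (prod_decode i)))" for i
  define \<epsilon> where "\<epsilon> i = 1 / real (Suc (snd (prod_decode (fst (prod_decode i)))))" for i
  define \<delta> where "\<delta> i = \<alpha> * (1 / 2) ^ Suc i" for i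
  have "\<exists>k A. 1 \<le> k \<and> A \<in> sets (coord_filtration (enat k)) \<and>
    (\<forall>R\<in>space (prob_algebra borel). (\<integral>x. h (m i) x \<partial>iid_power (n (m i)) R) \<le> 0 \<longrightarrow>
       measure (iid_seq R) A \<le> \<delta> i) \<and>
    (\<forall>R\<in>space (prob_algebra borel). 2 * \<epsilon> i \<le> (\<integral>x. h (m i) x \<partial>iid_power (n (m i)) R) \<longrightarrow>
       1 - \<delta> i \<le> measure (iid_seq R) A)" for i
    using cert \<open>0 < \<alpha>\<close> unfolding certifying_family_def
    by (intro ex_block_event) (auto simp: \<epsilon>_def \<delta>_def)
  then obtain k A where k: "\<And>i. 1 \<le> k i"
    and A: "\<And>i. A i \<in> sets (coord_filtration (enat (k i)))"
    and level: "\<And>i R. R \<in> space (prob_algebra borel) \<Longrightarrow>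
      (\<integral>x. h (m i) x \<partial>iid_power (n (m i)) R) \<le> 0 \<Longrightarrow> measure (iid_seq R) (A i) \<le> \<delta> i"
    and power: "\<And>i R. R \<in> space (prob_algebra borel) \<Longrightarrow>
      2 * \<epsilon> i \<le> (\<integral>x. h (m i) x \<partial>iid_power (n (m i)) R) \<Longrightarrow> 1 - \<delta> i \<le> measure (iid_seq R) (A i)"
    by metis
  obtain \<tau> where \<tau>: "sequential_test \<tau>" "{\<omega>. \<tau> \<omega> < \<infinity>} = (\<Union>i. A i)"
    by (rule sequential_test_of_events[of A k, OF A k])
  have sets_A: "A i \<in> sets (iid_seq R)" if "R \<in> space (prob_algebra borel)" for i and R :: "'a measure"
  proof -
    have "sets (iid_seq R) = sets (iid_seq borel)"
      using that by (intro sets_PiM_cong) (auto simp: space_prob_algebra)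
    then show ?thesis using A[of i] sets_coord_filtration_subset by blast
  qed
  have prob_seq: "prob_space (iid_seq R)" if "R \<in> space (prob_algebra borel)" for R :: "'a measure"
    using that by (intro prob_space_PiM) (simp add: space_prob_algebra)
  have "level_test \<alpha> \<P> \<tau>"
    unfolding level_test_def \<tau>(2)
  proof (rule SUP_least)
    fix P assume "P \<in> \<P>"
    then have P: "P \<in> space (prob_algebra borel)" using sub by auto
    interpret prob_space "iid_seq P" by (rule prob_seq[OF P])
    have "(\<integral>x. h (m i) x \<partial>iid_power (n (m i)) P) \<le> 0" for i
    proof -
      have "ereal (\<integral>x. h (m i) x \<partial>iid_power (n (m i)) P) \<le> 0"
        using cert \<open>P \<in> \<P>\<close> unfolding certifying_family_def by (metis (no_types, lifting) SUP_le_iff)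
      then show ?thesis by simp
    qed
    then have A_le: "emeasure (iid_seq P) (A i) \<le> ennreal (\<delta> i)" for i
      using level[OF P] by (simp add: emeasure_eq_measure ennreal_leI)
    have \<delta>_sums: "\<delta> sums (\<alpha> * 1)" unfolding \<delta>_def by (intro sums_mult power_half_series)
    have "0 \<le> \<delta> i" for i using \<open>0 < \<alpha>\<close> by (simp add: \<delta>_def)
    from suminf_ennreal_eq[OF this \<delta>_sums] have "(\<Sum>i. ennreal (\<delta> i)) = ennreal \<alpha>" by simp
    moreover have "emeasure (iid_seq P) (\<Union>i. A i) \<le> (\<Sum>i. emeasure (iid_seq P) (A i))"
      using sets_A[OF P] by (intro emeasure_subadditive_countably) auto
    moreover have "\<dots> \<le> (\<Sum>i. ennreal (\<delta> i))" by (intro suminf_le A_le) auto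
    ultimately show "emeasure (iid_seq P) (\<Union>i. A i) \<le> ennreal \<alpha>" by simp
  qed
  moreover have "power_one Q \<tau>" if "Q \<in> \<Q>" for Q
  proof -
    have Q: "Q \<in> space (prob_algebra borel)" using that sub by auto
    interpret prob_space "iid_seq Q" by (rule prob_seq[OF Q])
    obtain j where j: "0 < (\<integral>x. h j x \<partial>iid_power (n j) Q)"
      using cert \<open>Q \<in> \<Q>\<close> unfolding certifying_family_def by blast
    then obtain r where r: "1 / real (Suc r) < (\<integral>x. h j x \<partial>iid_power (n j) Q) / 2"
      by (metis half_gt_zero inverse_eq_divide reals_Archimedean)
    have "1 - \<delta> l \<le> prob (\<Union>i. A i)" for l
    proof -
      define i where "i = prod_encode (prod_encode (j, r), l)"
      have "\<delta> i \<le> \<delta> l" unfolding \<delta>_def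
        using \<open>0 < \<alpha>\<close> le_prod_encode_2[of l "prod_encode (j, r)"]
        by (intro mult_left_mono power_decreasing) (auto simp: i_def)
      moreover have "1 - \<delta> i \<le> prob (A i)"
        using r by (intro power[OF Q]) (simp add: m_def \<epsilon>_def i_def)
      moreover have "prob (A i) \<le> prob (\<Union>i. A i)"
        using sets_A[OF Q] by (intro finite_measure_mono) auto
      ultimately show ?thesis by linarith
    qed
    moreover have "(\<lambda>l. 1 - \<delta> l) \<longlonglongrightarrow> 1 - \<alpha> * 0"
      unfolding \<delta>_def by (intro tendsto_intros LIMSEQ_Suc LIMSEQ_power_zero) simp
    ultimately have "1 \<le> prob (\<Union>i. A i)" by (intro LIMSEQ_le_const2) auto
    then show ?thesis
      unfolding power_one_def \<tau>(2) emeasure_eq_measure by (simp add: measure_ge_1_iff)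
  qed
  ultimately show ?thesis unfolding testable_at_level_def using \<tau>(1) by blast
qed

lemma ex_quadratic_certificate:
  fixes \<P> :: "'a::topological_space measure set"
  assumes comp: "compactin weak_topology \<P>"
    and f: "\<And>n. continuous_on UNIV (f n)" "\<And>n. bounded (range (f n))"
    and Q: "Q \<in> space (prob_algebra borel)"
    and sep: "\<And>P. P \<in> \<P> \<Longrightarrow> \<exists>n. (\<integral>x. f n x \<partial>P) \<noteq> (\<integral>x. f n x \<partial>Q)"
  obtains q c where
    "\<And>P. P \<in> \<P> \<Longrightarrow> (\<integral>x. quadratic_certificate f q c x \<partial>iid_power 2 P) \<le> 0"
    "0 < (\<integral>x. quadratic_certificate f q c x \<partial>iid_power 2 Q)"
proof -
  define v where "v i = (\<integral>x. f i x \<partial>Q)" for i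
  obtain N d where "d > 0" and d: "\<And>P. P \<in> \<P> \<Longrightarrow> d \<le> (\<Sum>i<N. ((\<integral>x. f i x \<partial>P) - v i)\<^sup>2)"
    using finite_separation_from_compactin[of _ f, OF comp f sep] unfolding v_def by blast
  define e where "e = min 1 (d / (8 * real (Suc N)))"
  have e: "0 < e" "e \<le> 1" "real N * e \<le> d / 8"
  proof -
    show "0 < e" "e \<le> 1" using \<open>d > 0\<close> by (auto simp: e_def)
    have "real N * e \<le> real (Suc N) * (d / (8 * real (Suc N)))"
      using \<open>d > 0\<close> by (intro mult_mono) (auto simp: e_def)
    also have "\<dots> = d / 8" by (simp del: of_nat_Suc)
    finally show "real N * e \<le> d / 8" .
  qed
  have "\<exists>r. v i < of_rat r \<and> of_rat r < v i + e" for i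
    using of_rat_dense[of "v i" "v i + e"] e(1) by auto
  then obtain r where r: "\<And>i. v i < of_rat (r i)" "\<And>i. of_rat (r i) < v i + e" by metis
  have r_sq: "(v i - of_rat (r i))\<^sup>2 \<le> e" for i
  proof -
    have "(v i - of_rat (r i))\<^sup>2 \<le> e\<^sup>2" using r[of i] e(1) by (subst power2_le_iff_abs_le) auto
    also have "\<dots> \<le> e" using e by (simp add: power2_eq_square mult_left_le)
    finally show ?thesis .
  qed
  have "(\<Sum>i<N. (v i - of_rat (r i))\<^sup>2) \<le> (\<Sum>i<N. e)" by (intro sum_mono r_sq)
  then have near: "(\<Sum>i<N. (v i - of_rat (r i))\<^sup>2) \<le> d / 8" using e(3) by simp
  obtain c where c: "d / 8 < of_rat c" "of_rat c < d / 4"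
    using of_rat_dense[of "d / 8" "d / 4"] \<open>d > 0\<close> by auto
  define q where "q = map r [0..<N]"
  have int: "(\<integral>x. quadratic_certificate f q c x \<partial>iid_power 2 R) =
      of_rat c - (\<Sum>i<N. ((\<integral>x. f i x \<partial>R) - of_rat (r i))\<^sup>2)"
    if "R \<in> space (prob_algebra borel)" for R
    using integral_quadratic_certificate[of f, OF f that, of q c] by (simp add: q_def)
  show thesis
  proof (rule that[of q c])
    show "0 < (\<integral>x. quadratic_certificate f q c x \<partial>iid_power 2 Q)"
      using near c by (simp add: int[OF Q] flip: v_def)
  next
    fix P assume "P \<in> \<P>"
    then have P: "P \<in> space (prob_algebra borel)"
      using comp by (auto simp: compactin_def topspace_weak_topology)
    define u where "u i = (\<integral>x. f i x \<partial>P)" for i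
    have "(u i - v i)\<^sup>2 \<le> 2 * (u i - of_rat (r i))\<^sup>2 + 2 * (v i - of_rat (r i))\<^sup>2" for i
      using zero_le_power2[of "(u i - of_rat (r i)) + (v i - of_rat (r i))"]
      by (simp add: power2_eq_square algebra_simps)
    then have "(\<Sum>i<N. (u i - v i)\<^sup>2) \<le>
        (\<Sum>i<N. 2 * (u i - of_rat (r i))\<^sup>2 + 2 * (v i - of_rat (r i))\<^sup>2)" by (intro sum_mono)
    then have "d \<le> 2 * (\<Sum>i<N. (u i - of_rat (r i))\<^sup>2) + 2 * (\<Sum>i<N. (v i - of_rat (r i))\<^sup>2)"
      using d[OF \<open>P \<in> \<P>\<close>] by (simp add: u_def sum.distrib sum_distrib_left)
    then show "(\<integral>x. quadratic_certificate f q c x \<partial>iid_power 2 P) \<le> 0"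
      using near c by (simp add: int[OF P] flip: u_def)
  qed
qed

theorem proposition3p18:
  fixes \<P> :: "'a::polish_space measure set"
  assumes "\<P> \<noteq> {}"
    and "compactin weak_topology \<P>"
  shows
    "(\<forall>Q \<in> space (prob_algebra borel). Q \<notin> \<P> \<longrightarrow>
        (\<exists>h :: (nat \<Rightarrow> 'a) \<Rightarrow> real.
           bounded_continuous_on_power 2 h \<and> symmetric_on_power 2 h \<and>
           (SUP P\<in>\<P>. ereal (\<integral>x. h x \<partial>iid_power 2 P)) \<le> 0 \<and>
           0 < (\<integral>x. h x \<partial>iid_power 2 Q))) \<and>
     (\<forall>\<Q>. \<Q> \<noteq> {} \<and> \<Q> \<subseteq> space (prob_algebra borel) \<and> \<P> \<inter> \<Q> = {} \<longrightarrow>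
        sequentially_testable \<P> \<Q> \<and>
        (\<exists>h. certifying_family \<P> \<Q> (\<lambda>_. 2) h))"
proof -
  obtain f :: "nat \<Rightarrow> 'a \<Rightarrow> real" where f: "\<And>n. continuous_on UNIV (f n)" "\<And>n. bounded (range (f n))"
    and det: "\<And>P Q. P \<in> space (prob_algebra borel) \<Longrightarrow> Q \<in> space (prob_algebra borel) \<Longrightarrow>
       (\<And>n. (\<integral>x. f n x \<partial>P) = (\<integral>x. f n x \<partial>Q)) \<Longrightarrow> P = Q"
    using ex_countable_determining_functions by blast
  have \<P>_sub: "\<P> \<subseteq> space (prob_algebra borel)"
    using assms(2) by (auto simp: compactin_def topspace_weak_topology)
  have ex: "\<exists>q c. (\<forall>P\<in>\<P>. (\<integral>x. quadratic_certificate f q c x \<partial>iid_power 2 P) \<le> 0) \<and>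
      0 < (\<integral>x. quadratic_certificate f q c x \<partial>iid_power 2 Q)"
    if Q: "Q \<in> space (prob_algebra borel)" "Q \<notin> \<P>" for Q
  proof -
    have "\<exists>n. (\<integral>x. f n x \<partial>P) \<noteq> (\<integral>x. f n x \<partial>Q)" if "P \<in> \<P>" for P
      using det[of P Q] Q \<P>_sub that by blast
    from ex_quadratic_certificate[of _ f, OF assms(2) f Q(1) this] show ?thesis by metis
  qed
  define valid where
    "valid q c \<longleftrightarrow> (\<forall>P\<in>\<P>. (\<integral>x. quadratic_certificate f q c x \<partial>iid_power 2 P) \<le> 0)" for q c
  define h where "h m = (case from_nat m of (q, c) \<Rightarrow>
    if valid q c then quadratic_certificate f q c else (\<lambda>_. 0))" for m :: nat
  have cert: "certifying_family \<P> \<Q> (\<lambda>_. 2) h"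
    if "\<Q> \<subseteq> space (prob_algebra borel)" "\<P> \<inter> \<Q> = {}" for \<Q>
    unfolding certifying_family_def
  proof (intro conjI allI ballI)
    fix m :: nat
    obtain q c where qc: "from_nat m = (q :: rat list, c :: rat)" by (metis surj_pair)
    show "h m \<in> borel_measurable (iid_power 2 borel)"
      using measurable_quadratic_certificate[of f, OF f(1)] by (simp add: h_def qc)
    show "bounded (h m ` space (iid_power 2 borel))"
      using bounded_continuous_quadratic_certificate[of f, OF f, of q c]
      by (auto simp: h_def qc space_PiM bounded_continuous_on_power_def image_constant_conv)
    show "(SUP P\<in>\<P>. ereal (\<integral>x. h m x \<partial>iid_power 2 P)) \<le> 0"
      by (rule SUP_least) (auto simp: h_def qc valid_def)
  next
    fix Q assume "Q \<in> \<Q>"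
    then have "Q \<in> space (prob_algebra borel)" "Q \<notin> \<P>" using that by auto
    from ex[OF this] obtain q c where "valid q c"
      "0 < (\<integral>x. quadratic_certificate f q c x \<partial>iid_power 2 Q)" unfolding valid_def by blast
    then show "\<exists>m. 0 < (\<integral>x. h m x \<partial>iid_power 2 Q)"
      by (intro exI[of _ "to_nat (q, c)"]) (simp add: h_def)
  qed simp
  show ?thesis
  proof (intro conjI ballI allI impI)
    fix Q :: "'a measure" assume "Q \<in> space (prob_algebra borel)" "Q \<notin> \<P>"
    from ex[OF this] obtain q c
      where "\<forall>P\<in>\<P>. (\<integral>x. quadratic_certificate f q c x \<partial>iid_power 2 P) \<le> 0"
        "0 < (\<integral>x. quadratic_certificate f q c x \<partial>iid_power 2 Q)" by blast
    then show "\<exists>h :: (nat \<Rightarrow> 'a) \<Rightarrow> real.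
        bounded_continuous_on_power 2 h \<and> symmetric_on_power 2 h \<and>
        (SUP P\<in>\<P>. ereal (\<integral>x. h x \<partial>iid_power 2 P)) \<le> 0 \<and> 0 < (\<integral>x. h x \<partial>iid_power 2 Q)"
      using bounded_continuous_quadratic_certificate[of f, OF f] symmetric_quadratic_certificate
      by (intro exI[of _ "quadratic_certificate f q c"]) (auto intro!: SUP_least)
  next
    fix \<Q> assume \<Q>: "\<Q> \<noteq> {} \<and> \<Q> \<subseteq> space (prob_algebra borel) \<and> \<P> \<inter> \<Q> = {}"
    then show cert_\<Q>: "\<exists>h. certifying_family \<P> \<Q> (\<lambda>_. 2) h" using cert by blast
    have test: "\<forall>\<alpha>\<in>{0<..<1}. testable_at_level \<alpha> \<P> \<Q>"
      using testable_at_level_of_certifying_family[OF cert \<P>_sub] \<Q> by auto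
    moreover have "(1 / 2 :: real) \<in> {0<..<1}" by simp
    ultimately show "sequentially_testable \<P> \<Q>"
      unfolding sequentially_testable_def using cert_\<Q> by blast
  qed
qed

end
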